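(* For any partition $G=A_1\cup\dots\cup A_n$ of a group $G$ into conjugacy-invariant sets there is a cell $A_i$ of the partition such that $\mathrm{cov}(\Delta_{\mathcal I}(A_i))\le n$ for any left-invariant Boolean ideal $\mathcal I$ on $G$ with $\widehat{\mathsf{is}}_{12}(B)=0$ for all $B\in\mathcal I$.
   Context: A subset $A$ of $G$ is conjugacy-invariant if $xAx^{-1}=A$ for every $x\in G$. A Boolean ideal on $G$ is a non-empty family $\mathcal I$ of subsets of $G$ such that $A\cup B\in\mathcal I$ and $A\cap C\in\mathcal I$ for all $A,B\in\mathcal I$, $C\subset G$; it is left-invariant if $gA\in\mathcal I$ for all $A\in\mathcal I$, $g\in G$. Put $\Delta_{\mathcal I}(A)=\{x\in G:A\cap xA\notin\mathcal I\}$, and for non-empty $B\subset G$, $\mathrm{cov}(B)=\min\{|F|:F\subset G,\ G=FB\}$. $P_\omega(G)$ denotes the set of finitely supported probability measures on $G$ (finite convex combinations of Dirac measures), with convolution $\big(\sum_i\alpha_i\delta_{a_i}\big)*\big(\sum_j\beta_j\delta_{b_j}\big)=\sum_{i,j}\alpha_i\beta_j\delta_{a_ib_j}$. For $A\subset G$, $\mathsf{is}_{12}(A)=\inf_{\mu_1\in P_\omega(G)}\sup_{\mu_2\in P_\omega(G)}\mu_1*\mu_2(A)$ and $\widehat{\mathsf{is}}_{12}(A)=\sup_{B\subset G}\big(\mathsf{is}_{12}(A\cup B)-\mathsf{is}_{12}(B)\big)$. *)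

theory Defs
  imports
    "HOL-Algebra.Coset"
    "HOL-Library.Disjoint_Sets"
    "HOL-Library.Extended_Nat"
    "HOL-Probability.Probability_Mass_Function"
begin

definition conjugacy_invariant :: "('a, 'b) monoid_scheme \<Rightarrow> 'a set \<Rightarrow> bool" where
  "conjugacy_invariant G A \<longleftrightarrow>
     A \<subseteq> carrier G \<and> (\<forall>x\<in>carrier G. (x <#\<^bsub>G\<^esub> A) #>\<^bsub>G\<^esub> inv\<^bsub>G\<^esub> x = A)"

definition boolean_ideal :: "('a, 'b) monoid_scheme \<Rightarrow> 'a set set \<Rightarrow> bool" where
  "boolean_ideal G \<I> \<longleftrightarrow>
     \<I> \<noteq> {} \<and> \<I> \<subseteq> Pow (carrier G) \<and>
     (\<forall>A\<in>\<I>. \<forall>B\<in>\<I>. A \<union> B \<in> \<I>) \<and>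
     (\<forall>A\<in>\<I>. \<forall>C. C \<subseteq> carrier G \<longrightarrow> A \<inter> C \<in> \<I>)"

definition left_invariant :: "('a, 'b) monoid_scheme \<Rightarrow> 'a set set \<Rightarrow> bool" where
  "left_invariant G \<I> \<longleftrightarrow> (\<forall>g\<in>carrier G. \<forall>A\<in>\<I>. g <#\<^bsub>G\<^esub> A \<in> \<I>)"

definition Delta :: "('a, 'b) monoid_scheme \<Rightarrow> 'a set set \<Rightarrow> 'a set \<Rightarrow> 'a set" where
  "Delta G \<I> A = {x \<in> carrier G. A \<inter> (x <#\<^bsub>G\<^esub> A) \<notin> \<I>}"

text \<open>All infinite cardinalities are identified with \<open>\<infinity>\<close>.  The covering number is meant for
  non-empty \<open>B\<close>; for \<open>B = {}\<close> the infimum is over the empty set, so \<open>cov G {} = \<infinity>\<close> and a bound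
  \<open>cov G B \<le> enat n\<close> entails that \<open>B\<close> is non-empty.\<close>

definition cov :: "('a, 'b) monoid_scheme \<Rightarrow> 'a set \<Rightarrow> enat" where
  "cov G B =
     (INF F\<in>{F. F \<subseteq> carrier G \<and> carrier G = F <#>\<^bsub>G\<^esub> B}.
        if finite F then enat (card F) else \<infinity>)"

definition P_fin :: "('a, 'b) monoid_scheme \<Rightarrow> 'a pmf set" where
  "P_fin G = {\<mu>. finite (set_pmf \<mu>) \<and> set_pmf \<mu> \<subseteq> carrier G}"

text \<open>The law of \<open>a \<otimes> b\<close> for independent \<open>a\<close>, \<open>b\<close> with laws \<open>\<mu>\<close>, \<open>\<nu>\<close>: each pair \<open>(a, b)\<close>
  contributes \<open>pmf \<mu> a * pmf \<nu> b\<close> to the Dirac mass at \<open>a \<otimes> b\<close>.\<close>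

definition conv :: "('a, 'b) monoid_scheme \<Rightarrow> 'a pmf \<Rightarrow> 'a pmf \<Rightarrow> 'a pmf" where
  "conv G \<mu> \<nu> = map_pmf (\<lambda>(a, b). a \<otimes>\<^bsub>G\<^esub> b) (pair_pmf \<mu> \<nu>)"

text \<open>The real-valued infima and suprema below are over non-empty sets, bounded because measures of
  sets lie in \<open>[0, 1]\<close>.\<close>

definition is12 :: "('a, 'b) monoid_scheme \<Rightarrow> 'a set \<Rightarrow> real" where
  "is12 G A =
     (INF \<mu>\<^sub>1\<in>P_fin G. SUP \<mu>\<^sub>2\<in>P_fin G. measure_pmf.prob (conv G \<mu>\<^sub>1 \<mu>\<^sub>2) A)"

definition is12_hat :: "('a, 'b) monoid_scheme \<Rightarrow> 'a set \<Rightarrow> real" where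
  "is12_hat G A = (SUP B\<in>Pow (carrier G). is12 G (A \<union> B) - is12 G B)"

end

theory Submission
  imports Defs
begin

text \<open>On conjugacy-invariant sets \<open>is12\<close> is subadditive: if \<open>\<mu>\<close> is nearly optimal for \<open>A\<close> and
  \<open>\<nu>\<close> for \<open>B\<close>, then \<open>\<mu> * \<nu>\<close> is nearly optimal for both, because convolutions may be rotated
  cyclically when evaluated on a conjugacy-invariant set.  Hence some cell has \<open>is12 \<ge> 1/n\<close>.
  If \<open>F\<close> is a finite set such that the translates \<open>x A\<close>, \<open>x \<in> F\<close>, have pairwise intersections in
  the ideal, then deleting a member of the ideal from \<open>A\<close> makes the translates disjoint without
  decreasing \<open>is12\<close>, and the uniform measure on \<open>F\<inverse>\<close> witnesses \<open>is12 A \<le> 1/|F|\<close>.  Thus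
  \<open>|F| \<le> n\<close>, and for an \<open>F\<close> of maximal size \<open>F \<Delta>(A) = G\<close>.\<close>

no_notation (ASCII) subset_mset (infix \<open><#\<close> 50)

section \<open>Convolutions and bounds for \<open>is12\<close>\<close>

lemma prob_conv:
  "measure_pmf.prob (conv G \<mu> \<nu>) A =
     measure_pmf.prob (pair_pmf \<mu> \<nu>) {(a, b). a \<otimes>\<^bsub>G\<^esub> b \<in> A}"
  unfolding conv_def by (simp add: vimage_def case_prod_unfold)

lemma set_pmf_conv:
  "set_pmf (conv G \<mu> \<nu>) = (\<lambda>(a, b). a \<otimes>\<^bsub>G\<^esub> b) ` (set_pmf \<mu> \<times> set_pmf \<nu>)"
  unfolding conv_def by simp

text \<open>In monadic form, associativity of \<open>conv\<close> and the exchange of the two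
  independent draws become laws of \<open>bind_pmf\<close>.\<close>

lemma conv_eq_bind:
  "conv G \<mu> \<nu> = bind_pmf \<mu> (\<lambda>a. bind_pmf \<nu> (\<lambda>b. return_pmf (a \<otimes>\<^bsub>G\<^esub> b)))"
  unfolding conv_def pair_pmf_def by (simp add: map_bind_pmf)

lemma is12_le:
  assumes "\<mu> \<in> P_fin G" and "\<And>\<nu>. \<nu> \<in> P_fin G \<Longrightarrow> measure_pmf.prob (conv G \<mu> \<nu>) A \<le> c"
  shows "is12 G A \<le> c"
proof -
  have "(SUP \<nu>\<in>P_fin G. measure_pmf.prob (conv G \<mu> \<nu>) A) \<le> c"
    using assms by (intro cSUP_least) auto
  moreover have "is12 G A \<le> (SUP \<nu>\<in>P_fin G. measure_pmf.prob (conv G \<mu> \<nu>) A)"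
    unfolding is12_def
  proof (rule cINF_lower[OF _ assms(1)])
    \<comment> \<open>A real infimum is a lower bound only for a family bounded below. Here 0 works:
      each supremum dominates a probability, for instance the one at
      \<open>\<nu> = \<mu>'\<close>.\<close>
    show "bdd_below ((\<lambda>\<mu>. SUP \<nu>\<in>P_fin G. measure_pmf.prob (conv G \<mu> \<nu>) A) ` P_fin G)"
    proof (rule bdd_belowI2)
      fix \<mu>' assume "\<mu>' \<in> P_fin G"
      have "bdd_above ((\<lambda>\<nu>. measure_pmf.prob (conv G \<mu>' \<nu>) A) ` P_fin G)"
        by (rule bdd_aboveI2[where M = 1]) simp
      from cSUP_upper[OF \<open>\<mu>' \<in> P_fin G\<close> this]
      show "0 \<le> (SUP \<nu>\<in>P_fin G. measure_pmf.prob (conv G \<mu>' \<nu>) A)"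
        using measure_nonneg order_trans by blast
    qed
  qed
  ultimately show ?thesis by simp
qed

lemma P_fin_nonempty:
  assumes "x \<in> carrier G"
  shows "P_fin G \<noteq> {}"
proof -
  have "return_pmf x \<in> P_fin G" using assms by (simp add: P_fin_def)
  then show ?thesis by blast
qed

lemma is12_lessE:
  assumes "is12 G A < c" and "P_fin G \<noteq> {}"
  obtains \<mu> where "\<mu> \<in> P_fin G" "\<And>\<nu>. \<nu> \<in> P_fin G \<Longrightarrow> measure_pmf.prob (conv G \<mu> \<nu>) A < c"
proof -
  obtain \<mu> where \<mu>: "\<mu> \<in> P_fin G" "(SUP \<nu>\<in>P_fin G. measure_pmf.prob (conv G \<mu> \<nu>) A) < c"
    using cInf_lessD[of "(\<lambda>\<mu>. SUP \<nu>\<in>P_fin G. measure_pmf.prob (conv G \<mu> \<nu>) A) ` P_fin G" c] assms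
    unfolding is12_def by auto
  have "bdd_above ((\<lambda>\<nu>. measure_pmf.prob (conv G \<mu> \<nu>) A) ` P_fin G)"
    by (rule bdd_aboveI2[where M = 1]) simp
  then have "measure_pmf.prob (conv G \<mu> \<nu>) A < c" if "\<nu> \<in> P_fin G" for \<nu>
    using cSUP_upper[OF that] \<mu>(2) by fastforce
  with \<mu>(1) show thesis by (rule that)
qed

context group
begin

section \<open>Conjugacy invariance and subadditivity\<close>

lemma conv_P_fin:
  assumes "\<mu> \<in> P_fin G" "\<nu> \<in> P_fin G"
  shows "conv G \<mu> \<nu> \<in> P_fin G"
  using assms by (auto simp: P_fin_def set_pmf_conv)

lemma conv_assoc:
  assumes "\<mu> \<in> P_fin G" "\<nu> \<in> P_fin G" "\<rho> \<in> P_fin G"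
  shows "conv G (conv G \<mu> \<nu>) \<rho> = conv G \<mu> (conv G \<nu> \<rho>)"
  using assms unfolding P_fin_def conv_eq_bind
  by (auto simp: bind_assoc_pmf bind_return_pmf m_assoc subset_iff intro!: bind_pmf_cong)

text \<open>\<open>b \<otimes> a\<close> is the conjugate of \<open>a \<otimes> b\<close> by
  \<open>b\<close>.\<close>

lemma conjugacy_invariant_rotate:
  assumes "conjugacy_invariant G A" "a \<in> carrier G" "b \<in> carrier G" "a \<otimes> b \<in> A"
  shows "b \<otimes> a \<in> A"
proof -
  have "b \<otimes> (a \<otimes> b) \<otimes> inv b \<in> A"
    using assms unfolding conjugacy_invariant_def l_coset_def r_coset_def by blast
  moreover have "b \<otimes> (a \<otimes> b) \<otimes> inv b = b \<otimes> a"
    using assms by (simp add: m_assoc)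
  ultimately show ?thesis by simp
qed

lemma conjugacy_invariant_Union:
  assumes "\<And>i. i \<in> I \<Longrightarrow> conjugacy_invariant G (A i)"
  shows "conjugacy_invariant G (\<Union>i\<in>I. A i)"
proof -
  have "(x <# (\<Union>i\<in>I. A i)) #> inv x = (\<Union>i\<in>I. (x <# A i) #> inv x)" for x
    unfolding l_coset_def r_coset_def by blast
  with assms show ?thesis
    unfolding conjugacy_invariant_def by fastforce
qed

text \<open>The two convolutions may differ as measures; only their values on \<open>A\<close>
  agree. After the independent factors are swapped, the events \<open>a \<otimes> b \<in> A\<close>
  and \<open>b \<otimes> a \<in> A\<close> coincide on the supports, which lie in the carrier as
  rotation requires.\<close>

lemma prob_conv_commute:
  assumes "conjugacy_invariant G A" "\<mu> \<in> P_fin G" "\<nu> \<in> P_fin G"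
  shows "measure_pmf.prob (conv G \<mu> \<nu>) A = measure_pmf.prob (conv G \<nu> \<mu>) A"
proof -
  have "measure_pmf.prob (conv G \<mu> \<nu>) A
      = measure_pmf.prob (pair_pmf \<nu> \<mu>) {(b, a). a \<otimes> b \<in> A}"
    unfolding prob_conv by (subst pair_commute_pmf) (simp add: vimage_def case_prod_unfold)
  also have "\<dots> = measure_pmf.prob (pair_pmf \<nu> \<mu>) {(b, a). b \<otimes> a \<in> A}"
  proof (rule measure_pmf.finite_measure_eq_AE)
    show "AE p in measure_pmf (pair_pmf \<nu> \<mu>). (p \<in> {(b, a). a \<otimes> b \<in> A}) = (p \<in> {(b, a). b \<otimes> a \<in> A})"
      using assms conjugacy_invariant_rotate[OF assms(1)]
      by (auto simp: AE_measure_pmf_iff P_fin_def)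
  qed auto
  finally show ?thesis by (simp add: prob_conv)
qed

lemma is12_Un_le:
  assumes A: "conjugacy_invariant G A" and B: "conjugacy_invariant G B"
  shows "is12 G (A \<union> B) \<le> is12 G A + is12 G B"
proof (rule field_le_epsilon)
  fix e :: real assume "e > 0"
  have ne: "P_fin G \<noteq> {}" using one_closed by (rule P_fin_nonempty)
  obtain \<mu> where \<mu>: "\<mu> \<in> P_fin G"
    "\<And>\<nu>. \<nu> \<in> P_fin G \<Longrightarrow> measure_pmf.prob (conv G \<mu> \<nu>) A < is12 G A + e / 2"
    using is12_lessE[of G A "is12 G A + e / 2"] ne \<open>e > 0\<close> by auto
  obtain \<nu> where \<nu>: "\<nu> \<in> P_fin G"
    "\<And>\<rho>. \<rho> \<in> P_fin G \<Longrightarrow> measure_pmf.prob (conv G \<nu> \<rho>) B < is12 G B + e / 2"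
    using is12_lessE[of G B "is12 G B + e / 2"] ne \<open>e > 0\<close> by auto
  show "is12 G (A \<union> B) \<le> is12 G A + is12 G B + e"
  proof (rule is12_le)
    show "conv G \<mu> \<nu> \<in> P_fin G" using \<mu> \<nu> conv_P_fin by blast
  next
    fix \<rho> assume \<rho>: "\<rho> \<in> P_fin G"
    let ?p = "conv G (conv G \<mu> \<nu>) \<rho>"
    \<comment> \<open>Reassociated, \<open>?p\<close> is \<open>\<mu>\<close> followed by
      \<open>conv G \<nu> \<rho>\<close>, one of the measures that \<open>\<mu>\<close> was chosen
      against.\<close>
    have "measure_pmf.prob ?p A < is12 G A + e / 2"
      using \<mu> \<nu> \<rho> by (simp add: conv_assoc conv_P_fin)
    \<comment> \<open>Rotating \<open>\<mu>\<close> to the end puts \<open>\<nu>\<close> first,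
      against the measure \<open>conv G \<rho> \<mu>\<close>.\<close>
    moreover have "measure_pmf.prob ?p B = measure_pmf.prob (conv G \<nu> (conv G \<rho> \<mu>)) B"
      using \<mu> \<nu> \<rho> prob_conv_commute[OF B, of \<mu> "conv G \<nu> \<rho>"] by (simp add: conv_assoc conv_P_fin)
    moreover have "\<dots> < is12 G B + e / 2"
      using \<mu> \<nu> \<rho> conv_P_fin by blast
    moreover have "measure_pmf.prob ?p (A \<union> B) \<le> measure_pmf.prob ?p A + measure_pmf.prob ?p B"
      by (rule measure_Un_le) auto
    ultimately show "measure_pmf.prob ?p (A \<union> B) \<le> is12 G A + is12 G B + e" by linarith
  qed
qed

section \<open>Extreme values of \<open>is12\<close> and finite unions\<close>

lemma is12_empty_le: "is12 G {} \<le> 0"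
  by (rule is12_le[where \<mu> = "return_pmf \<one>"]) (auto simp: P_fin_def)

lemma is12_nonneg: "0 \<le> is12 G A"
proof (rule ccontr)
  assume "\<not> 0 \<le> is12 G A"
  then have "is12 G A < 0" by simp
  then obtain \<mu> where "\<mu> \<in> P_fin G" "\<And>\<nu>. \<nu> \<in> P_fin G \<Longrightarrow> measure_pmf.prob (conv G \<mu> \<nu>) A < 0"
    using P_fin_nonempty[OF one_closed] by (rule is12_lessE) blast
  then show False by (meson measure_nonneg not_less)
qed

lemma is12_le_1: "is12 G A \<le> 1"
  by (rule is12_le[where \<mu> = "return_pmf \<one>"]) (auto simp: P_fin_def)

lemma is12_carrier: "1 \<le> is12 G (carrier G)"
proof (rule ccontr)
  assume "\<not> 1 \<le> is12 G (carrier G)"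
  then have "is12 G (carrier G) < 1" by simp
  then obtain \<mu> where \<mu>: "\<mu> \<in> P_fin G"
    "\<And>\<nu>. \<nu> \<in> P_fin G \<Longrightarrow> measure_pmf.prob (conv G \<mu> \<nu>) (carrier G) < 1"
    using P_fin_nonempty[OF one_closed] by (rule is12_lessE) blast
  have "conv G \<mu> \<mu> \<in> P_fin G" using \<mu> conv_P_fin by blast
  then have "measure_pmf.prob (conv G \<mu> \<mu>) (carrier G) = 1"
    by (auto simp: P_fin_def measure_pmf.prob_eq_1 AE_measure_pmf_iff)
  with \<mu> show False by force
qed

lemma is12_Union_le:
  assumes "finite I" and "\<And>i. i \<in> I \<Longrightarrow> conjugacy_invariant G (A i)"
  shows "is12 G (\<Union>i\<in>I. A i) \<le> (\<Sum>i\<in>I. is12 G (A i))"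
  using assms
proof (induction I rule: finite_induct)
  case empty
  then show ?case using is12_empty_le by simp
next
  case (insert i I)
  have "is12 G (A i \<union> (\<Union>i\<in>I. A i)) \<le> is12 G (A i) + is12 G (\<Union>i\<in>I. A i)"
    using insert.prems by (intro is12_Un_le conjugacy_invariant_Union) auto
  with insert show ?case by force
qed

text \<open>\<open>A - B\<close> is an admissible competitor in the supremum defining
  \<open>is12_hat G B\<close>. The differences there are at most 1, so the supremum is a genuine
  upper bound.\<close>

lemma is12_le_Diff:
  assumes "A \<subseteq> carrier G" and "is12_hat G B = 0" and "B \<subseteq> A"
  shows "is12 G A \<le> is12 G (A - B)"
proof -
  have "bdd_above ((\<lambda>C. is12 G (B \<union> C) - is12 G C) ` Pow (carrier G))"
    by (rule bdd_aboveI2[where M = 1]) (use is12_nonneg is12_le_1 in \<open>smt (verit)\<close>)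
  then have "is12 G (B \<union> (A - B)) - is12 G (A - B) \<le> is12_hat G B"
    unfolding is12_hat_def using assms by (intro cSUP_upper) auto
  moreover have "B \<union> (A - B) = A" using assms by blast
  ultimately show ?thesis using assms(2) by simp
qed

text \<open>For fixed \<open>b\<close>, \<open>inv x \<otimes> b\<close> lies in \<open>A\<close>
  only if \<open>b\<close> lies in \<open>x <# A\<close>, which by disjointness happens for at most
  one \<open>x\<close> in \<open>F\<close>. So the uniform measure on the inverses, translated by
  \<open>b\<close>, gives \<open>A\<close> at most \<open>1 / card F\<close>, and averaging over
  \<open>b\<close> keeps the bound.\<close>

lemma is12_le_inverse_card:
  assumes F: "F \<subseteq> carrier G" "finite F" "F \<noteq> {}" and A: "A \<subseteq> carrier G"
    and disj: "disjoint_family_on (\<lambda>x. x <# A) F"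
  shows "is12 G A \<le> 1 / card F"
proof (rule is12_le)
  let ?E = "m_inv G ` F"
  have E: "finite ?E" "?E \<noteq> {}" "?E \<subseteq> carrier G" using F by auto
  have cE: "card ?E = card F"
    using F by (intro card_image inj_on_subset[OF inv_inj]) auto
  show "pmf_of_set ?E \<in> P_fin G" using E by (simp add: P_fin_def)
  fix \<nu> assume \<nu>: "\<nu> \<in> P_fin G"
  have bound: "measure_pmf.prob (map_pmf (\<lambda>a. a \<otimes> b) (pmf_of_set ?E)) A \<le> 1 / card F"
    if b: "b \<in> carrier G" for b
  proof -
    have mem: "b \<in> x <# A" if "x \<in> F" "inv x \<otimes> b \<in> A" for x
    proof -
      have "b = x \<otimes> (inv x \<otimes> b)"
        using that F b by (simp add: m_assoc[symmetric] subset_iff)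
      then show ?thesis using that unfolding l_coset_def by blast
    qed
    have "x = y" if "x \<in> F" "y \<in> F" "inv x \<otimes> b \<in> A" "inv y \<otimes> b \<in> A" for x y
      using mem[OF that(1,3)] mem[OF that(2,4)] disj that(1,2)
      unfolding disjoint_family_on_def by (metis IntI empty_iff)
    then have "\<forall>u\<in>?E \<inter> (\<lambda>a. a \<otimes> b) -` A. \<forall>v\<in>?E \<inter> (\<lambda>a. a \<otimes> b) -` A. u = v"
      by auto
    then have "card (?E \<inter> (\<lambda>a. a \<otimes> b) -` A) \<le> 1"
      using E(1) by (simp add: card_le_Suc0_iff_eq)
    then show ?thesis
      using E cE by (simp add: measure_pmf_of_set divide_right_mono)
  qed
  \<comment> \<open>Drawing \<open>b\<close> first turns the probability into the
    \<open>\<nu>\<close>-average of the quantities in \<open>bound\<close>.\<close>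
  have "conv G (pmf_of_set ?E) \<nu> = bind_pmf \<nu> (\<lambda>b. map_pmf (\<lambda>a. a \<otimes> b) (pmf_of_set ?E))"
    unfolding conv_eq_bind by (subst bind_commute_pmf) (simp add: map_pmf_def)
  then have "measure_pmf.prob (conv G (pmf_of_set ?E) \<nu>) A
      = measure_pmf.expectation \<nu>
          (\<lambda>b. measure_pmf.prob (map_pmf (\<lambda>a. a \<otimes> b) (pmf_of_set ?E)) A)"
    by (simp only: measure_pmf_bind) (rule measure_pmf.measure_bind[where N = "count_space UNIV"],
        auto intro: measure_pmf_in_subprob_space)
  also have "\<dots> \<le> 1 / card F"
  proof (rule measure_pmf.integral_le_const)
    show "integrable (measure_pmf \<nu>)
        (\<lambda>b. measure_pmf.prob (map_pmf (\<lambda>a. a \<otimes> b) (pmf_of_set ?E)) A)"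
      by (rule measure_pmf.integrable_const_bound[where B = 1]) auto
    show "AE b in measure_pmf \<nu>. measure_pmf.prob (map_pmf (\<lambda>a. a \<otimes> b) (pmf_of_set ?E)) A \<le> 1 / card F"
      using \<nu> bound by (auto simp: AE_measure_pmf_iff P_fin_def)
  qed
  finally show "measure_pmf.prob (conv G (pmf_of_set ?E) \<nu>) A \<le> 1 / card F" .
qed

section \<open>Translates modulo a Boolean ideal\<close>

lemma l_coset_inv_cancel:
  assumes "x \<in> carrier G" "A \<subseteq> carrier G"
  shows "inv x <# (x <# A) = A"
  using assms by (simp add: lcos_m_assoc lcos_mult_one)

lemma l_coset_Int:
  assumes "x \<in> carrier G" "A \<subseteq> carrier G" "B \<subseteq> carrier G"
  shows "x <# (A \<inter> B) = (x <# A) \<inter> (x <# B)"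
proof -
  have "x <# C = (\<lambda>g. x \<otimes> g) ` C" for C
    unfolding l_coset_def by blast
  then show ?thesis
    using inj_on_image_Int[OF inj_on_cmult[OF assms(1)] assms(2,3)] by simp
qed

lemma boolean_ideal_subset:
  assumes "boolean_ideal G \<I>" "A \<in> \<I>" "B \<subseteq> A"
  shows "B \<in> \<I>"
  using assms unfolding boolean_ideal_def by (metis PowD inf.absorb2 order_trans subsetD)

lemma boolean_ideal_Union:
  assumes I: "boolean_ideal G \<I>" and "finite J" "\<And>j. j \<in> J \<Longrightarrow> B j \<in> \<I>"
  shows "(\<Union>j\<in>J. B j) \<in> \<I>"
  using assms(2,3)
proof (induction J rule: finite_induct)
  case empty
  obtain C where "C \<in> \<I>" using I unfolding boolean_ideal_def by auto
  then show ?case using boolean_ideal_subset[OF I] by simp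
next
  case (insert j J)
  then show ?case using I unfolding boolean_ideal_def by simp
qed

lemma is12_le_inverse_card_almost_disjoint:
  assumes I: "boolean_ideal G \<I>" "left_invariant G \<I>" "\<forall>B\<in>\<I>. is12_hat G B = 0"
    and A: "A \<subseteq> carrier G"
    and F: "F \<subseteq> carrier G" "finite F" "F \<noteq> {}"
    and small: "\<And>x y. x \<in> F \<Longrightarrow> y \<in> F \<Longrightarrow> x \<noteq> y \<Longrightarrow> (x <# A) \<inter> (y <# A) \<in> \<I>"
  shows "is12 G A \<le> 1 / card F"
proof -
  \<comment> \<open>\<open>B\<close> collects the points of \<open>A\<close> that some
    \<open>x\<close> in \<open>F\<close> moves into another translate \<open>y <# A\<close>. Pulling
    each overlap back by \<open>inv x\<close> keeps it in the ideal and places it inside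
    \<open>A\<close>.\<close>
  define B where "B = (\<Union>(x, y)\<in>{(x, y). x \<in> F \<and> y \<in> F \<and> x \<noteq> y}. inv x <# ((x <# A) \<inter> (y <# A)))"
  have "finite {(x, y). x \<in> F \<and> y \<in> F \<and> x \<noteq> y}"
    by (rule finite_subset[of _ "F \<times> F"]) (use F in auto)
  moreover have "inv x <# ((x <# A) \<inter> (y <# A)) \<in> \<I>" if "x \<in> F" "y \<in> F" "x \<noteq> y" for x y
    using small[OF that] I(2) that F unfolding left_invariant_def by auto
  ultimately have B: "B \<in> \<I>"
    unfolding B_def by (intro boolean_ideal_Union[OF I(1)]) auto
  have "inv x <# ((x <# A) \<inter> (y <# A)) \<subseteq> A" if "x \<in> F" for x y
  proof -
    have "inv x <# ((x <# A) \<inter> (y <# A)) \<subseteq> inv x <# (x <# A)"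
      unfolding l_coset_def by blast
    also have "\<dots> = A" using F(1) A that by (intro l_coset_inv_cancel) auto
    finally show ?thesis .
  qed
  then have "B \<subseteq> A" unfolding B_def by blast
  have "disjoint_family_on (\<lambda>x. x <# (A - B)) F"
    unfolding disjoint_family_on_def
  proof (intro ballI impI)
    fix x y assume xy: "x \<in> F" "y \<in> F" "x \<noteq> y"
    have False if z: "z \<in> x <# (A - B)" "z \<in> y <# (A - B)" for z
    proof -
      \<comment> \<open>A common point \<open>z\<close> of the two translates pulls back under
        \<open>x\<close> to \<open>a\<close>, which is thereby one of the deleted points.\<close>
      obtain a where a: "a \<in> A - B" "z = x \<otimes> a" using z(1) unfolding l_coset_def by blast
      have "z \<in> (x <# A) \<inter> (y <# A)" using z unfolding l_coset_def by blast
      then have "inv x \<otimes> z \<in> inv x <# ((x <# A) \<inter> (y <# A))"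
        unfolding l_coset_def[of G "inv x"] by blast
      then have "inv x \<otimes> z \<in> B"
        using xy unfolding B_def by (intro UN_I[of "(x, y)"]) auto
      moreover have "inv x \<otimes> z = a"
        using a xy F A by (simp add: m_assoc[symmetric] subset_iff)
      ultimately show False using a by simp
    qed
    then show "(x <# (A - B)) \<inter> (y <# (A - B)) = {}" by blast
  qed
  then have "is12 G (A - B) \<le> 1 / card F"
    using F A by (intro is12_le_inverse_card) auto
  moreover have "is12 G A \<le> is12 G (A - B)"
    using A B I \<open>B \<subseteq> A\<close> by (intro is12_le_Diff) auto
  ultimately show ?thesis by simp
qed

section \<open>Covering by a maximal almost disjoint family\<close>

lemma cov_Delta_le:
  assumes I: "boolean_ideal G \<I>" "left_invariant G \<I>" "\<forall>B\<in>\<I>. is12_hat G B = 0"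
    and A: "A \<subseteq> carrier G" and n: "n > 0" "1 / real n \<le> is12 G A"
  shows "cov G (Delta G \<I> A) \<le> enat n"
proof -
  define P where "P F \<longleftrightarrow> F \<subseteq> carrier G \<and> finite F \<and>
    (\<forall>x\<in>F. \<forall>y\<in>F. x \<noteq> y \<longrightarrow> (x <# A) \<inter> (y <# A) \<in> \<I>)" for F
  have bound: "card F \<le> n" if "P F" for F
  proof (cases "F = {}")
    case False
    with that have "is12 G A \<le> 1 / card F"
      unfolding P_def by (intro is12_le_inverse_card_almost_disjoint[OF I A]) auto
    moreover have "card F > 0" using False that by (auto simp: P_def card_gt_0_iff)
    ultimately have "1 / real n \<le> 1 / real (card F)" using n by linarith
    then show ?thesis using n \<open>card F > 0\<close> by (simp add: field_simps)
  qed simp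
  \<comment> \<open>The empty set starts the search and \<open>bound\<close> caps it, so an almost
    disjoint family of largest size exists.\<close>
  have "P {}" by (simp add: P_def)
  then obtain F where F: "P F" and max: "\<And>F'. P F' \<Longrightarrow> card F' \<le> card F"
    using ex_has_greatest_nat[of P "{}" card "Suc n"] bound by (meson le_imp_less_Suc)
  have Fc: "F \<subseteq> carrier G" "finite F" using F by (auto simp: P_def)
  \<comment> \<open>This serves the case \<open>g \<in> F\<close>, where the overlap of
    \<open>g <# A\<close> with itself is all of \<open>g <# A\<close>. Membership would force
    \<open>is12 G A \<le> is12 G {} \<le> 0\<close>, against the positive lower bound.\<close>
  have AI: "A \<notin> \<I>"
  proof
    assume "A \<in> \<I>"
    then have "is12 G A \<le> is12 G (A - A)" using I A by (intro is12_le_Diff) auto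
    then show False using n is12_empty_le by (smt (verit) Diff_cancel divide_pos_pos of_nat_0_less_iff)
  qed
  have key: "\<exists>x\<in>F. g \<in> x <# Delta G \<I> A" if g: "g \<in> carrier G" for g
  proof -
    have "\<exists>x\<in>F. (x <# A) \<inter> (g <# A) \<notin> \<I>"
    proof (cases "g \<in> F")
      case True
      have "g <# A \<notin> \<I>"
      proof
        assume "g <# A \<in> \<I>"
        then have "inv g <# (g <# A) \<in> \<I>" using I(2) g unfolding left_invariant_def by blast
        then show False using AI g A by (simp add: l_coset_inv_cancel)
      qed
      then show ?thesis by (intro bexI[OF _ True]) simp
    next
      case False
      \<comment> \<open>The enlarged set exceeds the maximal size, so some pair violates almost
        disjointness. As \<open>F\<close> has no such pair, it involves \<open>g\<close>, in either
        order.\<close>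
      then have "\<not> P (insert g F)" using max[of "insert g F"] Fc by auto
      with F g show ?thesis unfolding P_def by (auto simp: Int_commute)
    qed
    then obtain x where x: "x \<in> F" "(x <# A) \<inter> (g <# A) \<notin> \<I>" by blast
    have xc: "x \<in> carrier G" using x Fc by blast
    \<comment> \<open>By left invariance, if the overlap of \<open>A\<close> with its translate by
      \<open>inv x \<otimes> g\<close> were in the ideal, so would be the overlap found
      above.\<close>
    have eq: "x <# (A \<inter> ((inv x \<otimes> g) <# A)) = (x <# A) \<inter> (g <# A)"
    proof -
      have "x <# ((inv x \<otimes> g) <# A) = g <# A"
        using xc g A by (simp add: lcos_m_assoc m_assoc[symmetric])
      then show ?thesis using xc g A by (simp add: l_coset_Int l_coset_subset_G)
    qed
    have "A \<inter> ((inv x \<otimes> g) <# A) \<notin> \<I>"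
      using x eq I(2) xc unfolding left_invariant_def by metis
    then have "inv x \<otimes> g \<in> Delta G \<I> A" using xc g by (simp add: Delta_def)
    moreover have "g = x \<otimes> (inv x \<otimes> g)" using xc g by (simp add: m_assoc[symmetric])
    ultimately show ?thesis using x(1) unfolding l_coset_def by blast
  qed
  have "F <#> Delta G \<I> A \<subseteq> carrier G"
    using Fc by (auto simp: set_mult_def Delta_def)
  with key have "carrier G = F <#> Delta G \<I> A"
    unfolding set_mult_def l_coset_def by blast
  then have "cov G (Delta G \<I> A) \<le> (if finite F then enat (card F) else \<infinity>)"
    unfolding cov_def using Fc by (intro INF_lower) auto
  then show ?thesis using Fc bound[OF F] by (simp add: order_trans)
qed

end

theorem corollary7p5:
  fixes G :: "('a, 'b) monoid_scheme" and A :: "nat \<Rightarrow> 'a set" and n :: nat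
  assumes "group G"
    and "carrier G = (\<Union>i\<in>{1..n}. A i)"
    and "disjoint_family_on A {1..n}"
    and "\<forall>i\<in>{1..n}. conjugacy_invariant G (A i)"
  shows "\<exists>i\<in>{1..n}. \<forall>\<I>.
           boolean_ideal G \<I> \<and> left_invariant G \<I> \<and> (\<forall>B\<in>\<I>. is12_hat G B = 0)
           \<longrightarrow> cov G (Delta G \<I> (A i)) \<le> enat n"
proof -
  interpret group G by fact
  \<comment> \<open>With \<open>n = 0\<close> the union would be empty, yet it contains
    \<open>\<one>\<close>.\<close>
  have n: "n > 0" using assms(2) one_closed by (cases n) auto
  have "1 \<le> (\<Sum>i\<in>{1..n}. is12 G (A i))"
    using is12_carrier is12_Union_le[of "{1..n}" A] assms(2,4) by force
  moreover have "(\<Sum>i\<in>{1..n}. is12 G (A i)) < (\<Sum>i\<in>{1..n}. 1 / real n)"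
    if "\<forall>i\<in>{1..n}. is12 G (A i) < 1 / real n"
    using that n by (intro sum_strict_mono) auto
  \<comment> \<open>Averaging: \<open>n\<close> values all below \<open>1 / n\<close> cannot sum to
    1. The choice of \<open>i\<close> depends on \<open>is12\<close> alone, so one cell serves every
    ideal.\<close>
  ultimately obtain i where i: "i \<in> {1..n}" "1 / real n \<le> is12 G (A i)"
    using n by (fastforce simp: not_less)
  have "A i \<subseteq> carrier G" using i assms(2) by blast
  with i n show ?thesis by (blast intro: cov_Delta_le)
qed

end
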